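(* The hierarchical distributed algorithm is mathematically equivalent to the centralized primal-dual gradient algorithm (both defined in the context). That is: let $\epsilon>0$, and suppose both algorithms start from the same $(\bm p(0),\bm q(0))\in\bm{\mathcal Y}$ and the same $\underline{\bm\mu}(0),\overline{\bm\mu}(0)\in\mathbb R^N_{\ge 0}$, where in the hierarchical algorithm $\alpha_i(0),\beta_i(0)$ are computed from $\underline{\bm\mu}(0),\overline{\bm\mu}(0)$ by the coordination formulas (C1)-(C3) of the context. Then for every $t\ge 0$ the iterates $(\bm p(t),\bm q(t),\underline{\bm\mu}(t),\overline{\bm\mu}(t))$ generated by the two algorithms coincide.
   Context: Network. Let $\mathcal T=\{\mathcal N\cup\{0\},\mathcal E\}$ be a finite tree rooted at node $0$, $\mathcal N=\{1,\dots,N\}$, where each line $(h,k)\in\mathcal E$ has resistance $r_{hk}$ and reactance $x_{hk}$ (real numbers). For $i\in\mathcal N$, $\mathcal E_i\subseteq\mathcal E$ is the set of lines on the unique path from $0$ to $i$. Define symmetric $N\times N$ matrices $R,X$ by $R_{ij}=\sum_{(h,k)\in\mathcal E_i\cap\mathcal E_j}r_{hk}$ and $X_{ij}=\sum_{(h,k)\in\mathcal E_i\cap\mathcal E_j}x_{hk}$. Clustering. A subtree of $\mathcal T$ is a tree consisting of a node of $\mathcal T$, all of its descendants in $\mathcal T$ (with respect to root $0$), and their connecting lines. The set $\mathcal N$ is partitioned as $\mathcal N=\mathcal N_0\cup\bigcup_{k\in\mathcal K}\mathcal N_k$ (pairwise disjoint), $\mathcal K=\{1,\dots,K\}$, where for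 $k\in\mathcal K$ the set $\mathcal N_k$ is the node set of a subtree $\mathcal T_k$ with root node $n_k^0\in\mathcal N_k$, and $\mathcal N_0$ is the set of remaining ("unclustered") nodes. Data. For $i\in\mathcal N$: $\mathcal Y_i\subset\mathbb R^2$ is a nonempty convex compact set, $C_i:\mathbb R^2\to\mathbb R$ is a continuously differentiable strongly convex cost function with first-order derivative bounded on $\mathcal Y_i$; $C_0:\mathbb R\to\mathbb R$ is continuously differentiable and convex with bounded first-order derivative. $\bm{\mathcal Y}$ is the set of $(\bm p,\bm q)\in\mathbb R^N\times\mathbb R^N$ with $(p_i,q_i)\in\mathcal Y_i$ for all $i$. Given constants $\tilde{\bm v},\underline{\bm v},\overline{\bm v}\in\mathbb R^N$, $P_I\in\mathbb R$, $\phi>0$, put $\bm v(\bm p,\bm q)=R\bm p+X\bm q+\tilde{\bm v}$ and $P_0(\bm p)=-P_I-\sum_{i\in\mathcal N}p_i$. $[\cdot]_S$ denotes Euclidean projection onto $S$, and $[\cdot]_+$ denotes projection onto the nonnegative orthant. Write $\bm v(t)=\bm v(\bm p(t),\bm q(t))$. Dual update (the same in both algorithms): $\underline{\bm\mu}(t+1)=[\underline{\bm\mu}(t)+\epsilon(\underline{\bm v}-\bm v(t)-\phi\underline{\bm\mu}(t))]_+$ and $\overline{\bm\mu}(t+1)=[\overline{\bm\mu}(t)+\epsilon(\bm v(t)-\overline{\bm v}-\phi\overline{\bm\mu}(t))]_+$. Centralized primal-dual gradient algorithm: with $C(\bm p,\bm q)=\sum_{i\in\mathcal N}C_i(p_i,q_i)$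 and $\bm 1_N$ the all-ones vector, $(\bm p(t+1),\bm q(t+1))$ is the projection onto $\bm{\mathcal Y}$ of the pair $\big(\bm p(t)-\epsilon(\nabla_{\bm p}C(\bm p(t),\bm q(t))-C_0'(P_0(\bm p(t)))\bm 1_N+R^\top(\overline{\bm\mu}(t)-\underline{\bm\mu}(t))),\ \bm q(t)-\epsilon(\nabla_{\bm q}C(\bm p(t),\bm q(t))+X^\top(\overline{\bm\mu}(t)-\underline{\bm\mu}(t)))\big)$, together with the dual update. Hierarchical distributed algorithm: for each $i\in\mathcal N$, $(p_i(t+1),q_i(t+1))$ is the projection onto $\mathcal Y_i$ of the pair $\big(p_i(t)-\epsilon(\partial_{p_i}C_i(p_i(t),q_i(t))-C_0'(P_0(\bm p(t)))+\alpha_i(t)),\ q_i(t)-\epsilon(\partial_{q_i}C_i(p_i(t),q_i(t))+\beta_i(t))\big)$, together with the (componentwise) dual update, and then the signals $\alpha_i(t+1),\beta_i(t+1)$ are computed from $\underline{\bm\mu}(t+1),\overline{\bm\mu}(t+1)$ by the following coordination formulas, in which $d_j=\overline\mu_j-\underline\mu_j$ is evaluated at the same time index as the signals: (C1) for $k\in\mathcal K$: $\alpha_k^{\mathrm{out}}=\sum_{h\in\mathcal K,h\ne k}R_{n_h^0n_k^0}\sum_{j\in\mathcal N_h}d_j+\sum_{j\in\mathcal N_0}R_{jn_k^0}d_j$ and $\beta_k^{\mathrm{out}}=\sum_{h\in\mathcal K,h\ne k}X_{n_h^0n_k^0}\sum_{j\in\mathcal N_h}d_j+\sum_{j\in\mathcal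 N_0}X_{jn_k^0}d_j$; (C2) for $i\in\mathcal N_0$: $\alpha_i=\sum_{k\in\mathcal K}R_{in_k^0}\sum_{j\in\mathcal N_k}d_j+\sum_{j\in\mathcal N_0}R_{ij}d_j$ and $\beta_i=\sum_{k\in\mathcal K}X_{in_k^0}\sum_{j\in\mathcal N_k}d_j+\sum_{j\in\mathcal N_0}X_{ij}d_j$; (C3) for $k\in\mathcal K$ and $i\in\mathcal N_k$: $\alpha_i=\sum_{j\in\mathcal N_k}R_{ij}d_j+\alpha_k^{\mathrm{out}}$ and $\beta_i=\sum_{j\in\mathcal N_k}X_{ij}d_j+\beta_k^{\mathrm{out}}$. *)

theory Defs
  imports "HOL-Analysis.Analysis"
begin

text \<open>
  The non-root nodes are the elements of an arbitrary finite type \<open>'n\<close> (so \<open>N\<close> is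
  \<open>CARD('n)\<close>) and the node set of the tree is \<open>'n option\<close>, the root being \<open>None\<close>.
  A line is the unordered pair of its end points.
\<close>

definition node_path :: "'v set set \<Rightarrow> 'v \<Rightarrow> 'v list \<Rightarrow> 'v \<Rightarrow> bool" where
  "node_path E u xs w \<longleftrightarrow>
     xs \<noteq> [] \<and> hd xs = u \<and> last xs = w \<and> distinct xs \<and> successively (\<lambda>a b. {a, b} \<in> E) xs"

definition has_cycle :: "'v set set \<Rightarrow> bool" where
  "has_cycle E \<longleftrightarrow>
     (\<exists>xs. 3 \<le> length xs \<and> distinct xs \<and> successively (\<lambda>a b. {a, b} \<in> E) xs \<and>
           {last xs, hd xs} \<in> E)"

definition is_tree :: "'v set set \<Rightarrow> bool" where
  "is_tree E \<longleftrightarrow> (\<forall>e\<in>E. card e = 2) \<and> (\<forall>u w. \<exists>xs. node_path E u xs w) \<and> \<not> has_cycle E"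

definition root_path :: "'n option set set \<Rightarrow> 'n option \<Rightarrow> 'n option list" where
  "root_path E u = (THE xs. node_path E None xs u)"

definition lines_to :: "'n option set set \<Rightarrow> 'n \<Rightarrow> 'n option set set" where
  "lines_to E i =
     {{root_path E (Some i) ! m, root_path E (Some i) ! Suc m} |m.
        Suc m < length (root_path E (Some i))}"

text \<open>The matrix \<open>R\<close> for resistances \<open>z = r\<close>, and \<open>X\<close> for reactances \<open>z = x\<close>.\<close>

definition line_matrix :: "'n::finite option set set \<Rightarrow> ('n option set \<Rightarrow> real) \<Rightarrow> real^'n^'n" where
  "line_matrix E z = (\<chi> i j. \<Sum>e\<in>lines_to E i \<inter> lines_to E j. z e)"

definition descendants :: "'n option set set \<Rightarrow> 'n option \<Rightarrow> 'n option set" where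
  "descendants E u = {w. w \<noteq> u \<and> u \<in> set (root_path E w)}"

definition clustering ::
    "'n option set set \<Rightarrow> nat \<Rightarrow> 'n set \<Rightarrow> (nat \<Rightarrow> 'n set) \<Rightarrow> (nat \<Rightarrow> 'n) \<Rightarrow> bool" where
  "clustering E K N0 Ns n0 \<longleftrightarrow>
     (\<forall>k\<in>{1..K}. Some ` Ns k = insert (Some (n0 k)) (descendants E (Some (n0 k)))) \<and>
     (\<forall>h\<in>{1..K}. \<forall>k\<in>{1..K}. h \<noteq> k \<longrightarrow> Ns h \<inter> Ns k = {}) \<and>
     (\<forall>k\<in>{1..K}. N0 \<inter> Ns k = {}) \<and>
     N0 \<union> (\<Union>k\<in>{1..K}. Ns k) = UNIV"

text \<open>The gradient; junk value where \<open>f\<close> is not differentiable.\<close>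

definition grad :: "('a::real_inner \<Rightarrow> real) \<Rightarrow> 'a \<Rightarrow> 'a" where
  "grad f x = (THE D. GDERIV f x :> D)"

definition continuously_differentiable :: "('a::real_inner \<Rightarrow> real) \<Rightarrow> bool" where
  "continuously_differentiable f \<longleftrightarrow>
     (\<exists>g. (\<forall>x. GDERIV f x :> g x) \<and> continuous_on UNIV g)"

definition strongly_convex :: "('a::real_inner \<Rightarrow> real) \<Rightarrow> bool" where
  "strongly_convex f \<longleftrightarrow>
     (\<exists>m>0. \<forall>x y. \<forall>u\<in>{0..1}.
        f (u *\<^sub>R x + (1 - u) *\<^sub>R y)
          \<le> u * f x + (1 - u) * f y - m / 2 * u * (1 - u) * (norm (x - y))\<^sup>2)"

definition feasible :: "('n::finite \<Rightarrow> (real \<times> real) set) \<Rightarrow> ((real^'n) \<times> (real^'n)) set" where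
  "feasible Y = {(p, q). \<forall>i. (p $ i, q $ i) \<in> Y i}"

definition nonneg_orthant :: "(real^'n::finite) set" where
  "nonneg_orthant = {x. \<forall>i. 0 \<le> x $ i}"

definition total_cost :: "('n::finite \<Rightarrow> real \<times> real \<Rightarrow> real) \<Rightarrow> real^'n \<Rightarrow> real^'n \<Rightarrow> real" where
  "total_cost C p q = (\<Sum>i\<in>UNIV. C i (p $ i, q $ i))"

definition root_power :: "real \<Rightarrow> real^'n::finite \<Rightarrow> real" where
  "root_power PI p = - PI - (\<Sum>i\<in>UNIV. p $ i)"

definition voltage ::
    "real^'n^'n \<Rightarrow> real^'n^'n \<Rightarrow> real^'n \<Rightarrow> real^'n \<Rightarrow> real^'n \<Rightarrow> real^'n::finite" where
  "voltage R X v0 p q = R *v p + X *v q + v0"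

definition centralized_run ::
    "real^'n^'n \<Rightarrow> real^'n^'n \<Rightarrow> ('n \<Rightarrow> (real \<times> real) set) \<Rightarrow> ('n \<Rightarrow> real \<times> real \<Rightarrow> real) \<Rightarrow>
     (real \<Rightarrow> real) \<Rightarrow> real \<Rightarrow> real^'n \<Rightarrow> real^'n \<Rightarrow> real^'n \<Rightarrow> real \<Rightarrow> real \<Rightarrow>
     (nat \<Rightarrow> real^'n) \<Rightarrow> (nat \<Rightarrow> real^'n) \<Rightarrow> (nat \<Rightarrow> real^'n) \<Rightarrow> (nat \<Rightarrow> real^'n::finite) \<Rightarrow> bool" where
  "centralized_run R X Y C C0 PI v0 vlo vup \<phi> \<epsilon> p q \<mu>lo \<mu>up \<longleftrightarrow>
     (\<forall>t.
        (p (Suc t), q (Suc t)) =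
          closest_point (feasible Y)
            (p t - \<epsilon> *\<^sub>R (grad (\<lambda>p'. total_cost C p' (q t)) (p t)
                          - deriv C0 (root_power PI (p t)) *\<^sub>R 1
                          + transpose R *v (\<mu>up t - \<mu>lo t)),
             q t - \<epsilon> *\<^sub>R (grad (\<lambda>q'. total_cost C (p t) q') (q t)
                          + transpose X *v (\<mu>up t - \<mu>lo t))) \<and>
        \<mu>lo (Suc t) =
          closest_point nonneg_orthant
            (\<mu>lo t + \<epsilon> *\<^sub>R (vlo - voltage R X v0 (p t) (q t) - \<phi> *\<^sub>R \<mu>lo t)) \<and>
        \<mu>up (Suc t) =
          closest_point nonneg_orthant
            (\<mu>up t + \<epsilon> *\<^sub>R (voltage R X v0 (p t) (q t) - vup - \<phi> *\<^sub>R \<mu>up t)))"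

text \<open>
  The coordination formulas for \<open>d = \<mu>up - \<mu>lo\<close>: with \<open>M = R\<close> they
  determine \<open>out = \<alpha>out\<close> on the clusters and \<open>sig = \<alpha>\<close>, with \<open>M = X\<close> they determine
  \<open>\<beta>out\<close> and \<open>\<beta>\<close>.
\<close>

definition coordination ::
    "real^'n^'n \<Rightarrow> nat \<Rightarrow> 'n set \<Rightarrow> (nat \<Rightarrow> 'n set) \<Rightarrow> (nat \<Rightarrow> 'n) \<Rightarrow>
     real^'n \<Rightarrow> (nat \<Rightarrow> real) \<Rightarrow> real^'n::finite \<Rightarrow> bool" where
  "coordination M K N0 Ns n0 d out sig \<longleftrightarrow>
     (\<forall>k\<in>{1..K}. out k =
        (\<Sum>h\<in>{1..K} - {k}. M $ n0 h $ n0 k * (\<Sum>j\<in>Ns h. d $ j))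
          + (\<Sum>j\<in>N0. M $ j $ n0 k * d $ j)) \<and>
     (\<forall>i\<in>N0. sig $ i =
        (\<Sum>k\<in>{1..K}. M $ i $ n0 k * (\<Sum>j\<in>Ns k. d $ j)) + (\<Sum>j\<in>N0. M $ i $ j * d $ j)) \<and>
     (\<forall>k\<in>{1..K}. \<forall>i\<in>Ns k. sig $ i = (\<Sum>j\<in>Ns k. M $ i $ j * d $ j) + out k)"

definition hierarchical_run ::
    "real^'n^'n \<Rightarrow> real^'n^'n \<Rightarrow> nat \<Rightarrow> 'n set \<Rightarrow> (nat \<Rightarrow> 'n set) \<Rightarrow> (nat \<Rightarrow> 'n) \<Rightarrow>
     ('n \<Rightarrow> (real \<times> real) set) \<Rightarrow> ('n \<Rightarrow> real \<times> real \<Rightarrow> real) \<Rightarrow>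
     (real \<Rightarrow> real) \<Rightarrow> real \<Rightarrow> real^'n \<Rightarrow> real^'n \<Rightarrow> real^'n \<Rightarrow> real \<Rightarrow> real \<Rightarrow>
     (nat \<Rightarrow> real^'n) \<Rightarrow> (nat \<Rightarrow> real^'n) \<Rightarrow> (nat \<Rightarrow> real^'n) \<Rightarrow> (nat \<Rightarrow> real^'n) \<Rightarrow>
     (nat \<Rightarrow> nat \<Rightarrow> real) \<Rightarrow> (nat \<Rightarrow> nat \<Rightarrow> real) \<Rightarrow>
     (nat \<Rightarrow> real^'n) \<Rightarrow> (nat \<Rightarrow> real^'n::finite) \<Rightarrow> bool" where
  "hierarchical_run R X K N0 Ns n0 Y C C0 PI v0 vlo vup \<phi> \<epsilon> p q \<mu>lo \<mu>up \<alpha>out \<beta>out \<alpha> \<beta> \<longleftrightarrow>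
     (\<forall>t. coordination R K N0 Ns n0 (\<mu>up t - \<mu>lo t) (\<alpha>out t) (\<alpha> t) \<and>
          coordination X K N0 Ns n0 (\<mu>up t - \<mu>lo t) (\<beta>out t) (\<beta> t)) \<and>
     (\<forall>t i.
        (p (Suc t) $ i, q (Suc t) $ i) =
          closest_point (Y i)
            (p t $ i - \<epsilon> * (deriv (\<lambda>x. C i (x, q t $ i)) (p t $ i)
                            - deriv C0 (root_power PI (p t)) + \<alpha> t $ i),
             q t $ i - \<epsilon> * (deriv (\<lambda>y. C i (p t $ i, y)) (q t $ i) + \<beta> t $ i)) \<and>
        \<mu>lo (Suc t) $ i =
          closest_point {0..}
            (\<mu>lo t $ i + \<epsilon> * (vlo $ i - voltage R X v0 (p t) (q t) $ i - \<phi> * \<mu>lo t $ i)) \<and>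
        \<mu>up (Suc t) $ i =
          closest_point {0..}
            (\<mu>up t $ i + \<epsilon> * (voltage R X v0 (p t) (q t) $ i - vup $ i - \<phi> * \<mu>up t $ i)))"

end

theory Submission
  imports Defs
begin

text \<open>
  Paths in a tree are unique, so the root path of a node contains the root path of each of its
  nodes as a prefix. Hence a line below the root \<open>n\<close> of a subtree never lies on the root path
  of a node outside the subtree, and the entries \<open>M i j\<close> of a line matrix, with \<open>i\<close> in the
  subtree and \<open>j\<close> outside, only depend on \<open>n\<close> and \<open>j\<close>. This turns the
  coordination signals into \<open>transpose M *v d\<close>. Since the cost, the feasible set and the orthant
  are products over the nodes, gradients and projections then split into components.
\<close>

section \<open>Paths in trees\<close>

text \<open>Induction along the first path. If both paths take the same first step, their tails
  agree by induction; if they part at \<open>u\<close>, the pieces up to the first place where they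
  meet again close a cycle.\<close>

lemma node_path_unique:
  assumes acyclic: "\<not> has_cycle E"
    and "node_path E u xs w" "node_path E u ys w"
  shows "xs = ys"
  using assms(2,3)
proof (induction xs arbitrary: u ys)
  case Nil
  then show ?case by (simp add: node_path_def)
next
  case (Cons x xs)
  from Cons.prems have x: "x = u" by (simp add: node_path_def)
  from Cons.prems obtain ys' where ys: "ys = u # ys'"
    by (cases ys) (auto simp: node_path_def)
  show ?case
  proof (cases "xs = [] \<or> ys' = []")
    case True
    then show ?thesis using Cons.prems x ys
      by (auto simp: node_path_def split: if_splits)
  next
    case False
    define a where "a = hd xs"
    define b where "b = hd ys'"
    have px: "node_path E a xs w" and py: "node_path E b ys' w"
      using Cons.prems False unfolding x ys a_def b_def
      by (auto simp: node_path_def successively_Cons)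
    have edges: "{u, a} \<in> E" "{u, b} \<in> E" and fresh: "u \<notin> set xs" "u \<notin> set ys'"
      using Cons.prems False unfolding x ys a_def b_def
      by (auto simp: node_path_def successively_Cons)
    show ?thesis
    proof (cases "a = b")
      case True
      then show ?thesis using Cons.IH px py x ys by blast
    next
      case False
      \<comment> \<open>The tails meet, at the latest in their common end \<open>w\<close>. Choosing
        \<open>c\<close> as the first node of \<open>xs\<close> on \<open>ys'\<close> keeps the
        stretch \<open>as\<close> before it disjoint from \<open>ys'\<close>.\<close>
      have "\<exists>c\<in>set xs. c \<in> set ys'"
        using px py unfolding node_path_def by (metis last_in_set)
      then obtain as c as' where as: "xs = as @ c # as'" and c: "c \<in> set ys'"
        and disj: "\<forall>z\<in>set as. z \<notin> set ys'"
        using split_list_first_prop[of xs "\<lambda>z. z \<in> set ys'"] by blast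
      from c obtain bs bs' where bs: "ys' = bs @ c # bs'" by (meson split_list)
      \<comment> \<open>Walk from \<open>u\<close> along \<open>xs\<close> to \<open>c\<close>, then
        backwards along \<open>ys'\<close> to its head \<open>b\<close>; the line from
        \<open>b\<close> to \<open>u\<close> closes the cycle.\<close>
      define cyc where "cyc = u # as @ c # rev bs"
      have ha: "hd (as @ [c]) = a" using as a_def by (cases as) auto
      have hb: "hd (bs @ [c]) = b" using bs b_def by (cases bs) auto
      have "distinct cyc"
        using px py fresh disj unfolding cyc_def node_path_def as bs by auto
      \<comment> \<open>If \<open>as\<close> and \<open>bs\<close> were both empty, then
        \<open>a = c = b\<close>, against the case assumption.\<close>
      moreover have "3 \<le> length cyc"
        using False ha hb unfolding cyc_def by (cases as; cases bs) auto
      moreover have "successively (\<lambda>a b. {a, b} \<in> E) cyc"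
      proof -
        have s1: "successively (\<lambda>a b. {a, b} \<in> E) (as @ [c])"
          using px unfolding node_path_def as by (auto simp: successively_append_iff)
        have "successively (\<lambda>a b. {a, b} \<in> E) (bs @ [c])"
          using py unfolding node_path_def bs by (auto simp: successively_append_iff)
        then have "successively (\<lambda>a b. {a, b} \<in> E) (rev (bs @ [c]))"
          unfolding successively_rev by (simp add: insert_commute)
        then have s2: "successively (\<lambda>a b. {a, b} \<in> E) (c # rev bs)" by simp
        have "successively (\<lambda>a b. {a, b} \<in> E) (as @ c # rev bs)"
          using s1 s2 by (auto simp: successively_append_iff)
        moreover have "hd (as @ c # rev bs) = a" using ha by (cases as) auto
        ultimately show ?thesis
          using edges unfolding cyc_def by (simp add: successively_Cons)
      qed
      moreover have "last cyc = b" using hb unfolding cyc_def by (cases bs) auto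
      then have "{last cyc, hd cyc} \<in> E"
        using edges unfolding cyc_def by (simp add: insert_commute)
      ultimately show ?thesis using acyclic unfolding has_cycle_def by blast
    qed
  qed
qed

text \<open>Uniqueness justifies the definite description in \<open>root_path\<close>, so a root
  path can be identified by exhibiting any path from the root.\<close>

lemma root_path_eqI:
  assumes "is_tree E" "node_path E None xs u"
  shows "root_path E u = xs"
  unfolding root_path_def
  using assms node_path_unique[of E None] by (auto simp: is_tree_def intro!: the_equality)

lemma node_path_root_path:
  assumes "is_tree E"
  shows "node_path E None (root_path E u) u"
  using assms root_path_eqI unfolding is_tree_def by metis

text \<open>Cutting the root path of \<open>w\<close> at one of its nodes leaves a simple path from
  the root to that node, and paths are unique.\<close>

lemma root_path_take:
  assumes tree: "is_tree E" and m: "m < length (root_path E w)"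
  shows "root_path E (root_path E w ! m) = take (Suc m) (root_path E w)"
proof (rule root_path_eqI[OF tree])
  let ?xs = "root_path E w"
  have p: "node_path E None ?xs w" by (rule node_path_root_path[OF tree])
  have "successively (\<lambda>a b. {a, b} \<in> E) (take (Suc m) ?xs @ drop (Suc m) ?xs)"
    using p by (simp add: node_path_def)
  then have "successively (\<lambda>a b. {a, b} \<in> E) (take (Suc m) ?xs)"
    unfolding successively_append_iff by blast
  then show "node_path E None (take (Suc m) ?xs) (?xs ! m)"
    using p m by (simp add: node_path_def last_conv_nth)
qed

lemma set_root_path_subset:
  assumes "is_tree E" "b \<in> set (root_path E w)"
  shows "set (root_path E b) \<subseteq> set (root_path E w)"
  using assms root_path_take by (metis in_set_conv_nth set_take_subset)

lemma self_in_root_path: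
  assumes "is_tree E"
  shows "u \<in> set (root_path E u)"
  using node_path_root_path[OF assms, of u] unfolding node_path_def by (metis last_in_set)

section \<open>The line matrices\<close>

text \<open>A line on the way to \<open>i\<close> that lies below \<open>n\<close> has an end point
  whose root path passes through \<open>n\<close>. If the way to \<open>j\<close> used this line, it
  would pass through \<open>n\<close> too.\<close>

lemma lines_to_subtree_inter:
  assumes tree: "is_tree E"
    and i: "Some n \<in> set (root_path E (Some i))"
    and j: "Some n \<notin> set (root_path E (Some j))"
  shows "lines_to E i \<inter> lines_to E j = lines_to E n \<inter> lines_to E j"
proof -
  let ?xs = "root_path E (Some i)"
  obtain l where l: "l < length ?xs" "?xs ! l = Some n"
    using i by (meson in_set_conv_nth)
  have rn: "root_path E (Some n) = take (Suc l) ?xs"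
    using root_path_take[OF tree l(1)] l(2) by simp
  have "lines_to E n \<subseteq> lines_to E i"
  proof
    fix e assume "e \<in> lines_to E n"
    then obtain m where "e = {take (Suc l) ?xs ! m, take (Suc l) ?xs ! Suc m}"
      "Suc m < length (take (Suc l) ?xs)"
      unfolding lines_to_def rn by blast
    then show "e \<in> lines_to E i" unfolding lines_to_def by auto
  qed
  moreover have "e \<in> lines_to E n" if ei: "e \<in> lines_to E i" and ej: "e \<in> lines_to E j" for e
  proof -
    obtain m where m: "e = {?xs ! m, ?xs ! Suc m}" "Suc m < length ?xs"
      using ei unfolding lines_to_def by blast
    have "e \<subseteq> set (root_path E (Some j))"
      using ej unfolding lines_to_def by auto
    \<comment> \<open>\<open>?xs ! Suc m\<close> is the end of \<open>e\<close> farther from the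
      root. Its root path consists of the first \<open>Suc (Suc m)\<close> nodes of
      \<open>?xs\<close>; as \<open>n\<close> is not among them, its position \<open>l\<close>
      exceeds \<open>Suc m\<close>, and \<open>e\<close> lies on the prefix ending in
      \<open>n\<close>.\<close>
    then have "set (root_path E (?xs ! Suc m)) \<subseteq> set (root_path E (Some j))"
      using set_root_path_subset[OF tree] m(1) by simp
    then have "Some n \<notin> set (take (Suc (Suc m)) ?xs)"
      using j root_path_take[OF tree m(2)] by auto
    then have "Suc m < l"
      using l by (metis in_set_conv_nth length_take min_less_iff_conj not_less_eq nth_take)
    then have "e = {take (Suc l) ?xs ! m, take (Suc l) ?xs ! Suc m}"
      "Suc m < length (take (Suc l) ?xs)"
      using m l by auto
    then show ?thesis unfolding lines_to_def rn by blast
  qed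
  ultimately show ?thesis by blast
qed

lemma line_matrix_sym: "line_matrix E z $ i $ j = line_matrix E z $ j $ i"
  by (simp add: line_matrix_def Int_commute)

text \<open>Trades the description by descendants, which lives in the option type, for a test on
  root paths. The cluster root fits in because it lies on its own root path.\<close>

lemma clustering_mem_iff:
  assumes tree: "is_tree E" and cl: "clustering E K N0 Ns n0" and k: "k \<in> {1..K}"
  shows "i \<in> Ns k \<longleftrightarrow> Some (n0 k) \<in> set (root_path E (Some i))"
proof -
  have "i \<in> Ns k \<longleftrightarrow> Some i \<in> Some ` Ns k" by auto
  also have "\<dots> \<longleftrightarrow> Some i \<in> insert (Some (n0 k)) (descendants E (Some (n0 k)))"
    using cl k unfolding clustering_def by metis
  also have "\<dots> \<longleftrightarrow> Some (n0 k) \<in> set (root_path E (Some i))"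
    using self_in_root_path[OF tree] by (auto simp: descendants_def)
  finally show ?thesis .
qed

lemma line_matrix_cluster:
  assumes "is_tree E" "clustering E K N0 Ns n0" "k \<in> {1..K}" "i \<in> Ns k" "j \<notin> Ns k"
  shows "line_matrix E z $ i $ j = line_matrix E z $ n0 k $ j"
  using lines_to_subtree_inter[OF assms(1)] clustering_mem_iff[OF assms(1-3)] assms(4,5)
  by (simp add: line_matrix_def)

lemma clustering_sum:
  fixes f :: "'n::finite \<Rightarrow> real"
  assumes "clustering E K N0 Ns n0"
  shows "(\<Sum>j\<in>UNIV. f j) = (\<Sum>j\<in>N0. f j) + (\<Sum>k\<in>{1..K}. \<Sum>j\<in>Ns k. f j)"
proof -
  have U: "UNIV = N0 \<union> (\<Union>k\<in>{1..K}. Ns k)" and "N0 \<inter> (\<Union>k\<in>{1..K}. Ns k) = {}"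
    and "\<forall>h\<in>{1..K}. \<forall>k\<in>{1..K}. h \<noteq> k \<longrightarrow> Ns h \<inter> Ns k = {}"
    using assms unfolding clustering_def by auto
  then show ?thesis
    unfolding U by (simp add: sum.union_disjoint sum.UNION_disjoint)
qed

text \<open>Splitting the product along the partition leaves one block of summands per cluster and
  one for \<open>N0\<close>. In each block coming from a different part than \<open>i\<close>, the
  clustered indices may be replaced by their cluster roots, which gives (C1)-(C3).\<close>

lemma coordination_line_matrix:
  assumes tree: "is_tree E" and cl: "clustering E K N0 Ns n0"
    and co: "coordination (line_matrix E z) K N0 Ns n0 d out sig"
  shows "sig = transpose (line_matrix E z) *v d"
proof (rule vec_eq_iff[THEN iffD2], rule allI)
  fix i
  let ?M = "line_matrix E z"
  have root: "n0 k \<in> Ns k" if "k \<in> {1..K}" for k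
    using clustering_mem_iff[OF tree cl that] self_in_root_path[OF tree] by simp
  have dj: "j \<notin> Ns k" if "j \<in> Ns h" "h \<noteq> k" "h \<in> {1..K}" "k \<in> {1..K}" for j h k
    using cl that unfolding clustering_def by blast
  have dj0: "j \<notin> Ns k" if "j \<in> N0" "k \<in> {1..K}" for j k
    using cl that unfolding clustering_def by blast
  have rhs: "(transpose ?M *v d) $ i =
      (\<Sum>j\<in>N0. ?M $ i $ j * d $ j) + (\<Sum>k\<in>{1..K}. \<Sum>j\<in>Ns k. ?M $ i $ j * d $ j)"
    using clustering_sum[OF cl, of "\<lambda>j. ?M $ i $ j * d $ j"]
    by (simp add: matrix_vector_mult_def transpose_def line_matrix_sym[of E z _ i])
  have "i \<in> N0 \<or> (\<exists>k\<in>{1..K}. i \<in> Ns k)"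
    using cl unfolding clustering_def by blast
  then show "sig $ i = (transpose ?M *v d) $ i"
  proof
    assume i: "i \<in> N0"
    \<comment> \<open>Here \<open>i\<close> is the outside node, so symmetry lets the replacement
      act on the column index.\<close>
    have "?M $ i $ j = ?M $ i $ n0 k" if "k \<in> {1..K}" "j \<in> Ns k" for k j
      using line_matrix_cluster[OF tree cl that dj0[OF i that(1)]]
      by (simp add: line_matrix_sym[of E z i])
    then have "(\<Sum>k\<in>{1..K}. \<Sum>j\<in>Ns k. ?M $ i $ j * d $ j) =
        (\<Sum>k\<in>{1..K}. ?M $ i $ n0 k * (\<Sum>j\<in>Ns k. d $ j))"
      by (simp add: sum_distrib_left)
    then show ?thesis
      using co i unfolding rhs coordination_def by simp
  next
    assume "\<exists>k\<in>{1..K}. i \<in> Ns k"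
    then obtain k where k: "k \<in> {1..K}" and i: "i \<in> Ns k" by blast
    have ext: "?M $ i $ j = ?M $ n0 k $ j" if "j \<notin> Ns k" for j
      by (rule line_matrix_cluster[OF tree cl k i that])
    \<comment> \<open>Two replacements: \<open>i\<close> by \<open>n0 k\<close>, since
      \<open>j\<close> is outside cluster \<open>k\<close>; then, after swapping indices,
      \<open>j\<close> by \<open>n0 h\<close>, since \<open>n0 k\<close> is outside cluster
      \<open>h\<close>.\<close>
    have "?M $ i $ j = ?M $ n0 h $ n0 k" if h: "h \<in> {1..K} - {k}" and j: "j \<in> Ns h" for h j
    proof -
      have "?M $ i $ j = ?M $ j $ n0 k"
        using ext[OF dj[OF j _ _ k]] h by (simp add: line_matrix_sym[of E z j])
      also have "\<dots> = ?M $ n0 h $ n0 k"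
        using h by (intro line_matrix_cluster[OF tree cl _ j dj[OF root[OF k]]]) (use k in auto)
      finally show ?thesis .
    qed
    then have others: "(\<Sum>h\<in>{1..K} - {k}. \<Sum>j\<in>Ns h. ?M $ i $ j * d $ j) =
        (\<Sum>h\<in>{1..K} - {k}. ?M $ n0 h $ n0 k * (\<Sum>j\<in>Ns h. d $ j))"
      by (simp add: sum_distrib_left)
    have unclustered: "(\<Sum>j\<in>N0. ?M $ i $ j * d $ j) = (\<Sum>j\<in>N0. ?M $ j $ n0 k * d $ j)"
      using ext dj0[OF _ k] by (intro sum.cong) (simp_all add: line_matrix_sym[of E z "n0 k"])
    have "(\<Sum>h\<in>{1..K}. \<Sum>j\<in>Ns h. ?M $ i $ j * d $ j) =
        (\<Sum>j\<in>Ns k. ?M $ i $ j * d $ j) + (\<Sum>h\<in>{1..K} - {k}. \<Sum>j\<in>Ns h. ?M $ i $ j * d $ j)"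
      using k by (intro sum.remove) auto
    then have "(transpose ?M *v d) $ i = (\<Sum>j\<in>Ns k. ?M $ i $ j * d $ j) + out k"
      using co k others unclustered unfolding rhs coordination_def by simp
    then show ?thesis
      using co k i unfolding coordination_def by simp
  qed
qed

section \<open>Componentwise projections and gradients\<close>

text \<open>The squared distance is the sum of the squared distances of the components, so it is
  minimised component by component. Abstract projections \<open>\<pi> i\<close> cover both the
  orthant and the feasible set.\<close>

lemma closest_point_orthogonal_product:
  fixes \<pi> :: "'i::finite \<Rightarrow> 'a::euclidean_space \<Rightarrow> 'b::euclidean_space"
  assumes lin: "\<And>i. bounded_linear (\<pi> i)"
    and norm: "\<And>x. (norm x)\<^sup>2 = (\<Sum>i\<in>UNIV. (norm (\<pi> i x))\<^sup>2)"
    and surj: "\<And>y. \<exists>x. \<forall>i. \<pi> i x = y i"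
    and S: "\<And>i. convex (S i)" "\<And>i. closed (S i)" "\<And>i. S i \<noteq> {}"
  shows "\<pi> i (closest_point {x. \<forall>i. \<pi> i x \<in> S i} a) = closest_point (S i) (\<pi> i a)"
proof -
  let ?P = "{x. \<forall>i. \<pi> i x \<in> S i}"
  \<comment> \<open>The candidate assembled from the component projections; uniqueness of the
    closest point of a closed convex set identifies it below.\<close>
  obtain x where x: "\<And>i. \<pi> i x = closest_point (S i) (\<pi> i a)"
    using surj[of "\<lambda>i. closest_point (S i) (\<pi> i a)"] by blast
  have P: "?P = (\<Inter>i. \<pi> i -` S i)" by auto
  have "convex ?P"
    unfolding P using S(1) bounded_linear.linear[OF lin]
    by (intro convex_INT convex_linear_vimage) auto
  moreover have "closed ?P"
    unfolding P using S(2) linear_continuous_on[OF lin]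
    by (intro closed_INT ballI closed_vimage) auto
  moreover have "x \<in> ?P" using S by (simp add: x closest_point_in_set)
  moreover have "dist a x \<le> dist a z" if z: "z \<in> ?P" for z
  proof -
    have d: "(dist a w)\<^sup>2 = (\<Sum>i\<in>UNIV. (dist (\<pi> i a) (\<pi> i w))\<^sup>2)" for w
      using norm[of "a - w"] by (simp add: dist_norm linear_diff[OF bounded_linear.linear[OF lin]])
    have "(dist a x)\<^sup>2 \<le> (dist a z)\<^sup>2"
      unfolding d x using z S by (intro sum_mono power_mono closest_point_le) auto
    then show ?thesis by (simp add: power2_le_iff_abs_le)
  qed
  ultimately have "x = closest_point ?P a" by (intro closest_point_unique) auto
  then show ?thesis using x by metis
qed

lemma norm_vec_power2: "(norm x)\<^sup>2 = (\<Sum>i\<in>UNIV. (norm (x $ i))\<^sup>2)"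
  by (simp add: norm_vec_def L2_set_def sum_nonneg)

lemma closest_point_nonneg_orthant:
  fixes a :: "real^'n::finite"
  shows "closest_point nonneg_orthant a $ i = closest_point {0..} (a $ i)"
proof -
  have "\<exists>x :: real^'n. \<forall>i. x $ i = y i" for y
    by (rule exI[of _ "\<chi> i. y i"]) simp
  then show ?thesis
    using closest_point_orthogonal_product
        [of "\<lambda>i x :: real^'n. x $ i" "\<lambda>i. {0..}", OF bounded_linear_vec_nth norm_vec_power2]
    by (simp add: nonneg_orthant_def)
qed

lemma closest_point_feasible:
  fixes Y :: "'n::finite \<Rightarrow> (real \<times> real) set"
  assumes "\<And>i. Y i \<noteq> {} \<and> convex (Y i) \<and> compact (Y i)"
    and "(p, q) = closest_point (feasible Y) (a, b)"
  shows "(p $ i, q $ i) = closest_point (Y i) (a $ i, b $ i)"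
proof -
  \<comment> \<open>The components are taken per node, regrouping the pair of vectors into the pairs
    on which the sets \<open>Y i\<close> act.\<close>
  let ?\<pi> = "\<lambda>i (z :: (real^'n) \<times> (real^'n)). (fst z $ i, snd z $ i)"
  have "bounded_linear (?\<pi> i)" for i
    by (intro bounded_linear_Pair bounded_linear_compose[OF bounded_linear_vec_nth]
        bounded_linear_fst bounded_linear_snd)
  moreover have "(norm z)\<^sup>2 = (\<Sum>i\<in>UNIV. (norm (?\<pi> i z))\<^sup>2)" for z
    by (simp add: norm_prod_def norm_vec_power2 sum.distrib sum_nonneg)
  moreover have "\<exists>z. \<forall>i. ?\<pi> i z = y i" for y
    by (rule exI[of _ "(\<chi> i. fst (y i), \<chi> i. snd (y i))"]) simp
  ultimately have "?\<pi> i (closest_point {z. \<forall>i. ?\<pi> i z \<in> Y i} (a, b)) = closest_point (Y i) (?\<pi> i (a, b))"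
    using assms(1) by (intro closest_point_orthogonal_product) (auto intro: compact_imp_closed)
  moreover have "{z. \<forall>i. ?\<pi> i z \<in> Y i} = feasible Y"
    by (auto simp: feasible_def)
  ultimately show ?thesis using assms(2) by (metis fst_conv snd_conv)
qed

lemma grad_eqI:
  assumes "GDERIV f x :> D"
  shows "grad f x = D"
  unfolding grad_def
proof (rule the_equality)
  fix D' assume "GDERIV f x :> D'"
  with assms have "(\<lambda>h. h \<bullet> D') = (\<lambda>h. h \<bullet> D)"
    unfolding gderiv_def by (rule has_derivative_unique[rotated])
  then show "D' = D" by (metis vector_eq_ldot)
qed (rule assms)

lemma GDERIV_separable_sum:
  fixes f :: "'n::finite \<Rightarrow> real \<Rightarrow> real"
  assumes "\<And>i. (f i has_real_derivative D i) (at (p $ i))"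
  shows "GDERIV (\<lambda>p. \<Sum>i\<in>UNIV. f i (p $ i)) p :> (\<chi> i. D i)"
proof -
  have "((\<lambda>p. \<Sum>i\<in>UNIV. f i (p $ i)) has_derivative (\<lambda>h. \<Sum>i\<in>UNIV. D i * h $ i)) (at p)"
    using assms unfolding has_field_derivative_def
    by (intro has_derivative_sum has_derivative_compose
        [OF bounded_linear_imp_has_derivative[OF bounded_linear_vec_nth]]) auto
  then show ?thesis
    by (simp add: gderiv_def inner_vec_def mult.commute)
qed

lemma GDERIV_partials:
  fixes f :: "real \<times> real \<Rightarrow> real"
  assumes "GDERIV f (a, b) :> (D1, D2)"
  shows "((\<lambda>x. f (x, b)) has_real_derivative D1) (at a)"
    and "((\<lambda>y. f (a, y)) has_real_derivative D2) (at b)"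
proof -
  have f: "(f has_derivative (\<lambda>h. fst h * D1 + snd h * D2)) (at (a, b))"
    using assms by (simp add: gderiv_def inner_prod_def)
  \<comment> \<open>Partial derivatives come from the chain rule along the two affine embeddings of
    the line through \<open>(a, b)\<close>.\<close>
  have 1: "((\<lambda>x. (x, b)) has_derivative (\<lambda>h. (h, 0))) (at a)"
    by (auto intro!: derivative_eq_intros)
  have 2: "((\<lambda>y. (a, y)) has_derivative (\<lambda>h. (0, h))) (at b)"
    by (auto intro!: derivative_eq_intros)
  show "((\<lambda>x. f (x, b)) has_real_derivative D1) (at a)"
    using has_derivative_compose[OF 1 f] by (simp add: has_field_derivative_def mult_commute_abs)
  show "((\<lambda>y. f (a, y)) has_real_derivative D2) (at b)"
    using has_derivative_compose[OF 2 f] by (simp add: has_field_derivative_def mult_commute_abs)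
qed

text \<open>Each summand depends on one coordinate only. Differentiability of every
  \<open>C i\<close> ensures that \<open>grad\<close> and \<open>deriv\<close> denote actual
  derivatives here.\<close>

lemma grad_total_cost:
  assumes "\<And>i. continuously_differentiable (C i)"
  shows "grad (\<lambda>p'. total_cost C p' q) p $ i = deriv (\<lambda>x. C i (x, q $ i)) (p $ i)"
    and "grad (\<lambda>q'. total_cost C p q') q $ i = deriv (\<lambda>y. C i (p $ i, y)) (q $ i)"
proof -
  have "\<forall>i. \<exists>D. GDERIV (C i) (p $ i, q $ i) :> D"
    using assms unfolding continuously_differentiable_def by blast
  then obtain D where "\<And>i. GDERIV (C i) (p $ i, q $ i) :> D i"
    unfolding choice_iff by blast
  then have "GDERIV (C i) (p $ i, q $ i) :> (fst (D i), snd (D i))" for i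
    by simp
  note d = GDERIV_partials[OF this]
  show "grad (\<lambda>p'. total_cost C p' q) p $ i = deriv (\<lambda>x. C i (x, q $ i)) (p $ i)"
    using grad_eqI[OF GDERIV_separable_sum[OF d(1)]] DERIV_imp_deriv[OF d(1)]
    by (simp add: total_cost_def)
  show "grad (\<lambda>q'. total_cost C p q') q $ i = deriv (\<lambda>y. C i (p $ i, y)) (q $ i)"
    using grad_eqI[OF GDERIV_separable_sum[OF d(2)]] DERIV_imp_deriv[OF d(2)]
    by (simp add: total_cost_def)
qed

section \<open>Equivalence of the algorithms\<close>


theorem mainTheorem1:
  fixes E :: "'n::finite option set set"
    and r x :: "'n option set \<Rightarrow> real"
    and R X :: "real^'n^'n"
    and K :: nat and N0 :: "'n set" and Ns :: "nat \<Rightarrow> 'n set" and n0 :: "nat \<Rightarrow> 'n"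
    and Y :: "'n \<Rightarrow> (real \<times> real) set"
    and C :: "'n \<Rightarrow> real \<times> real \<Rightarrow> real" and C0 :: "real \<Rightarrow> real"
    and v0 vlo vup :: "real^'n" and PI \<phi> \<epsilon> :: real
    and pC qC \<mu>loC \<mu>upC pH qH \<mu>loH \<mu>upH \<alpha> \<beta> :: "nat \<Rightarrow> real^'n"
    and \<alpha>out \<beta>out :: "nat \<Rightarrow> nat \<Rightarrow> real"
  assumes tree: "is_tree E"
    and R: "R = line_matrix E r"
    and X: "X = line_matrix E x"
    and clustering: "clustering E K N0 Ns n0"
    and Y: "\<And>i. Y i \<noteq> {} \<and> convex (Y i) \<and> compact (Y i)"
    and C: "\<And>i. continuously_differentiable (C i) \<and> strongly_convex (C i) \<and>
                 bounded (grad (C i) ` Y i)"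
    and C0: "C0 C1_differentiable_on UNIV" "convex_on UNIV C0" "bounded (range (deriv C0))"
    and "\<phi> > 0" and "\<epsilon> > 0"
    and centralized:
      "centralized_run R X Y C C0 PI v0 vlo vup \<phi> \<epsilon> pC qC \<mu>loC \<mu>upC"
    and hierarchical:
      "hierarchical_run R X K N0 Ns n0 Y C C0 PI v0 vlo vup \<phi> \<epsilon>
         pH qH \<mu>loH \<mu>upH \<alpha>out \<beta>out \<alpha> \<beta>"
    and same_start: "pH 0 = pC 0" "qH 0 = qC 0" "\<mu>loH 0 = \<mu>loC 0" "\<mu>upH 0 = \<mu>upC 0"
    and start: "(pC 0, qC 0) \<in> feasible Y" "\<mu>loC 0 \<in> nonneg_orthant" "\<mu>upC 0 \<in> nonneg_orthant"
  shows "\<forall>t. pH t = pC t \<and> qH t = qC t \<and> \<mu>loH t = \<mu>loC t \<and> \<mu>upH t = \<mu>upC t"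
proof
  fix t
  show "pH t = pC t \<and> qH t = qC t \<and> \<mu>loH t = \<mu>loC t \<and> \<mu>upH t = \<mu>upC t"
  proof (induction t)
    case 0
    show ?case using same_start by simp
  next
    case (Suc t)
    \<comment> \<open>The signals at time \<open>t\<close> are computed from the multipliers at the
      same \<open>t\<close>, which agree in both runs by induction.\<close>
    have signals: "\<alpha> t = transpose R *v (\<mu>upC t - \<mu>loC t)" "\<beta> t = transpose X *v (\<mu>upC t - \<mu>loC t)"
      using hierarchical coordination_line_matrix[OF tree clustering] Suc.IH
      unfolding hierarchical_run_def R X by metis+
    have gradients:
        "grad (\<lambda>p'. total_cost C p' (qC t)) (pC t) $ i = deriv (\<lambda>x. C i (x, qC t $ i)) (pC t $ i)"
        "grad (\<lambda>q'. total_cost C (pC t) q') (qC t) $ i = deriv (\<lambda>y. C i (pC t $ i, y)) (qC t $ i)"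
      for i
      using C by (intro grad_total_cost; blast)+
    have primal: "(pH (Suc t) $ i, qH (Suc t) $ i) = (pC (Suc t) $ i, qC (Suc t) $ i)" for i
    proof -
      have "(pC (Suc t), qC (Suc t)) =
          closest_point (feasible Y)
            (pC t - \<epsilon> *\<^sub>R (grad (\<lambda>p'. total_cost C p' (qC t)) (pC t)
                          - deriv C0 (root_power PI (pC t)) *\<^sub>R 1
                          + transpose R *v (\<mu>upC t - \<mu>loC t)),
             qC t - \<epsilon> *\<^sub>R (grad (\<lambda>q'. total_cost C (pC t) q') (qC t)
                          + transpose X *v (\<mu>upC t - \<mu>loC t)))"
        using centralized unfolding centralized_run_def by blast
      \<comment> \<open>Once the joint projection is split by nodes, the arguments of the
        projections onto \<open>Y i\<close> agree term by term.\<close>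
      from closest_point_feasible[OF Y this, of i] show ?thesis
        using hierarchical Suc.IH unfolding hierarchical_run_def
        by (simp add: gradients signals)
    qed
    have dual: "\<mu>loH (Suc t) $ i = \<mu>loC (Suc t) $ i" "\<mu>upH (Suc t) $ i = \<mu>upC (Suc t) $ i" for i
      using hierarchical centralized Suc.IH
      unfolding hierarchical_run_def centralized_run_def
      by (simp_all add: closest_point_nonneg_orthant)
    show ?case using primal dual by (simp add: vec_eq_iff)
  qed
qed

end
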